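(* Let $S$ be a random walk on its state space $\mathcal Z\subset\mathbb R^d$, $d\ge1$, and let $A\subset\mathcal Z$ be a Borel set such that the sets $A$, $-A$, $A^c$, $-A^c$ are massive for $S$, where $A^c=\mathcal Z\setminus A$. Then the measures $\mathbb P(X_1\in x-A^c)\,\lambda(dx)$ on $A$ and $\mathbb P(X_1\in A-x)\,\lambda(dx)$ on $A^c$ are invariant for the entrance chain $S^{\rangle A}$ and the exit chain $S^{A^c\rangle}$, respectively.
   Context: Random walk. $S_n=S_0+X_1+\dots+X_n$, where $X_1,X_2,\dots$ are i.i.d. random vectors in $\mathbb R^d$ (non-degenerate) and $S_0$ is independent of them. The state space $\mathcal Z$ is the minimal topologically closed subgroup of $(\mathbb R^d,+)$ containing the topological support of the distribution of $X_1$; it is assumed that $\mathcal Z$ has full dimension and $S_0\in\mathcal Z$. $\mathbb P_x$ denotes the law of the walk with $S_0=x$. $\lambda$ is the Haar measure on $\mathcal Z$ normalized so that $\lambda(Q)=1$, $Q:=\{x\in\mathcal Z:0\le x<1\}$ (inequalities coordinate-wise). A Borel set $B\subset\mathcal Z$ is massive for $S$ if $\mathbb P_x(\inf\{n\ge1:S_n\in B\}<\infty)=1$ for $\lambda$-a.e. $x\in\mathcal Z$. Entrance and exit chains. $T_0^{\rangle A}:=0$, $T_n^{\rangle A}:=\inf\{k>T_{n-1}^{\rangle A}:S_{k-1}\in A^c,S_k\in A\}$ for $n\ge1$ ($\inf\varnothing=\infty$); $S_n^{\rangle A}:=S_{T_n^{\rangle A}}$, $S_n^{A^c\rangle}:=S_{T_n^{\rangle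 A}-1}$ for $n\ge1$, with $S_\infty:=\dagger$, a cemetery state. $S^{\rangle A}$ is a Markov chain on $A\cup\{\dagger\}$ with kernel $P_A^{entr}(x,dy)=\mathbb P_x(S_1^{\rangle A}\in dy)$, $x\in A$. $S^{A^c\rangle}$ is a Markov chain on $A^c\cup\{\dagger\}$ with kernel $P_{A^c}^{exit}(x,dy)=\int_A\mathbb P_z(S_1^{A^c\rangle}\in dy)\,\mathbb P_x(S_1\in dz\mid S_1\in A)$ for $x\in A^c$ with $\mathbb P_x(S_1\in A)>0$, and $P_{A^c}^{exit}(x,\{\dagger\})=1$ for other $x\in A^c$. A Borel measure $\nu$ on $E\in\{A,A^c\}$ is invariant for a chain with kernel $K$ if $\int_E K(x,B)\,\nu(dx)=\nu(B)$ for every Borel $B\subset E$. *)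

theory Defs
  imports "HOL-Probability.Probability"
begin

definition add_subgroup :: "'a::group_add set \<Rightarrow> bool" where
  "add_subgroup G \<longleftrightarrow> 0 \<in> G \<and> (\<forall>x\<in>G. \<forall>y\<in>G. x + y \<in> G) \<and> (\<forall>x\<in>G. - x \<in> G)"

definition top_support :: "'a::topological_space measure \<Rightarrow> 'a set" where
  "top_support \<mu> = {x. \<forall>U. open U \<longrightarrow> x \<in> U \<longrightarrow> emeasure \<mu> U > 0}"

definition state_space :: "'w measure \<Rightarrow> (nat \<Rightarrow> 'w \<Rightarrow> real ^ 'd) \<Rightarrow> (real ^ 'd) set" where
  "state_space M X = (\<lambda>G. closed G \<and> add_subgroup G) hull top_support (distr M borel (X 1))"

(* The increments are X 1, X 2, ...; the value X 0 is irrelevant.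
   Full dimension refers to the linear span: dim Z is the dimension of span Z,
   so that for instance the integer lattice has full dimension.
   Non-degenerate means that X 1 is not almost surely constant. *)
locale random_walk = prob_space M
  for M :: "'w measure" and X S :: "nat \<Rightarrow> 'w \<Rightarrow> real ^ 'd" +
  assumes indep: "indep_vars (\<lambda>_. borel) (\<lambda>n. if n = 0 then S 0 else X n) UNIV"
    and identically_distributed: "\<And>n. n \<ge> 1 \<Longrightarrow> distr M borel (X n) = distr M borel (X 1)"
    and nondegenerate: "\<not> (\<exists>c. AE \<omega> in M. X 1 \<omega> = c)"
    and walk: "\<And>n \<omega>. \<omega> \<in> space M \<Longrightarrow> S n \<omega> = S 0 \<omega> + (\<Sum>k=1..n. X k \<omega>)"
    and full_dim: "dim (state_space M X) = CARD('d)"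
    and initial: "AE \<omega> in M. S 0 \<omega> \<in> state_space M X"

(* P_x, the law on path space of the walk started at x *)
definition walk_law ::
  "'w measure \<Rightarrow> (nat \<Rightarrow> 'w \<Rightarrow> real ^ 'd) \<Rightarrow> real ^ 'd \<Rightarrow> (nat \<Rightarrow> real ^ 'd) measure" where
  "walk_law M X x = distr M (\<Pi>\<^sub>M n\<in>UNIV. borel) (\<lambda>\<omega> n. x + (\<Sum>k=1..n. X k \<omega>))"

(* Local finiteness suffices here: on a closed subset of a Euclidean space
   it makes a Borel measure Radon. *)
definition haar_measure_on :: "(real ^ 'd) set \<Rightarrow> (real ^ 'd) measure \<Rightarrow> bool" where
  "haar_measure_on Z L \<longleftrightarrow>
     sets L = sets (restrict_space borel Z) \<and>
     emeasure L Z \<noteq> 0 \<and>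
     (\<forall>K. compact K \<longrightarrow> K \<subseteq> Z \<longrightarrow> emeasure L K < \<infinity>) \<and>
     (\<forall>z\<in>Z. \<forall>B\<in>sets L. emeasure L ((+) z ` B) = emeasure L B)"

definition normalized_haar_on :: "(real ^ 'd) set \<Rightarrow> (real ^ 'd) measure \<Rightarrow> bool" where
  "normalized_haar_on Z L \<longleftrightarrow>
     haar_measure_on Z L \<and> emeasure L {x \<in> Z. \<forall>i. 0 \<le> x $ i \<and> x $ i < 1} = 1"

definition hitting_time :: "'a set \<Rightarrow> (nat \<Rightarrow> 'a) \<Rightarrow> enat" where
  "hitting_time B s = Inf {enat n | n. n \<ge> 1 \<and> s n \<in> B}"

definition massive ::
  "'w measure \<Rightarrow> (nat \<Rightarrow> 'w \<Rightarrow> real ^ 'd) \<Rightarrow> (real ^ 'd) measure \<Rightarrow> (real ^ 'd) set \<Rightarrow> bool" where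
  "massive M X L B \<longleftrightarrow>
     B \<in> sets borel \<and> B \<subseteq> state_space M X \<and>
     (AE x in L. \<P>(s in walk_law M X x. hitting_time B s < \<infinity>) = 1)"

(* In the following, complements are taken in the state space Z. *)
primrec entrance_time :: "'a set \<Rightarrow> 'a set \<Rightarrow> (nat \<Rightarrow> 'a) \<Rightarrow> nat \<Rightarrow> enat" where
  "entrance_time Z A s 0 = 0"
| "entrance_time Z A s (Suc n) =
     Inf {enat k | k. enat k > entrance_time Z A s n \<and> s (k - 1) \<in> Z - A \<and> s k \<in> A}"

(* The cemetery state is None. *)
definition at_time :: "(nat \<Rightarrow> 'a) \<Rightarrow> enat \<Rightarrow> 'a option" where
  "at_time s t = (case t of enat k \<Rightarrow> Some (s k) | \<infinity> \<Rightarrow> None)"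

definition entrance_chain :: "'a set \<Rightarrow> 'a set \<Rightarrow> (nat \<Rightarrow> 'a) \<Rightarrow> nat \<Rightarrow> 'a option" where
  "entrance_chain Z A s n = at_time s (entrance_time Z A s n)"

(* Only used for n at least 1; note that \<infinity> - 1 = \<infinity> in enat. *)
definition exit_chain :: "'a set \<Rightarrow> 'a set \<Rightarrow> (nat \<Rightarrow> 'a) \<Rightarrow> nat \<Rightarrow> 'a option" where
  "exit_chain Z A s n = at_time s (entrance_time Z A s n - 1)"

definition entrance_kernel ::
  "'w measure \<Rightarrow> (nat \<Rightarrow> 'w \<Rightarrow> real ^ 'd) \<Rightarrow> (real ^ 'd) set \<Rightarrow>
   real ^ 'd \<Rightarrow> (real ^ 'd) option set \<Rightarrow> ennreal" where
  "entrance_kernel M X A x B =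
     emeasure (walk_law M X x)
       {s \<in> space (walk_law M X x). entrance_chain (state_space M X) A s 1 \<in> B}"

(* uniform_measure N A is the conditional distribution N(. | A). *)
definition exit_kernel ::
  "'w measure \<Rightarrow> (nat \<Rightarrow> 'w \<Rightarrow> real ^ 'd) \<Rightarrow> (real ^ 'd) set \<Rightarrow>
   real ^ 'd \<Rightarrow> (real ^ 'd) option set \<Rightarrow> ennreal" where
  "exit_kernel M X A x B =
     (if \<P>(s in walk_law M X x. s 1 \<in> A) > 0
      then (\<integral>\<^sup>+z\<in>A. emeasure (walk_law M X z)
                {s \<in> space (walk_law M X z). exit_chain (state_space M X) A s 1 \<in> B}
              \<partial>(uniform_measure (distr (walk_law M X x) borel (\<lambda>s. s 1)) A))
      else indicator B None)"

definition invariant_measure ::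
  "('a::topological_space \<Rightarrow> 'a option set \<Rightarrow> ennreal) \<Rightarrow> 'a set \<Rightarrow> 'a measure \<Rightarrow> bool" where
  "invariant_measure K E \<nu> \<longleftrightarrow>
     sets \<nu> = sets (restrict_space borel E) \<and>
     (\<forall>B\<in>sets borel. B \<subseteq> E \<longrightarrow> (\<integral>\<^sup>+x. K x (Some ` B) \<partial>\<nu>) = emeasure \<nu> B)"

end

theory Submission
  imports Defs
begin

text \<open>
  Let \<open>Q\<close> be the law of the increment sequence. Reversing the first \<open>m\<close> increments and moving the
  starting point to the position at time \<open>m\<close> preserves Haar measure times \<open>Q\<close> and turns the walk
  into the dual walk with steps \<open>- X\<close>. A path that leaves \<open>A\<^sup>c\<close> for \<open>A\<close> and makes its next such
  crossing at a step from \<open>B\<^sub>1\<close> to \<open>B\<^sub>2\<close> is thereby a dual path whose first step goes from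
  \<open>B\<^sub>2\<close> to \<open>B\<^sub>1\<close> and which later crosses from \<open>A\<close> to \<open>A\<^sup>c\<close>. As \<open>- A\<close> and \<open>- A\<^sup>c\<close> are massive, that
  later crossing almost surely happens, so the flux of the next crossings from \<open>B\<^sub>1\<close> to \<open>B\<^sub>2\<close>
  equals the flux of single steps from \<open>B\<^sub>1\<close> to \<open>B\<^sub>2\<close>. Taking \<open>B\<^sub>1 = A\<^sup>c\<close> gives the entrance chain
  and \<open>B\<^sub>2 = A\<close> the exit chain.
\<close>

section \<open>Paths, reversal and crossings\<close>

text \<open>The start is kept apart from the increments: it will be distributed by a sigma-finite
  measure that need not be finite, and only the increments carry a probability law.
  \<open>w k\<close> stands for \<open>X (Suc k)\<close>.\<close>

definition walk_path :: "'a::ab_group_add \<Rightarrow> (nat \<Rightarrow> 'a) \<Rightarrow> nat \<Rightarrow> 'a" where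
  "walk_path x w n = x + (\<Sum>k<n. w k)"

definition dual_path :: "'a::ab_group_add \<Rightarrow> (nat \<Rightarrow> 'a) \<Rightarrow> nat \<Rightarrow> 'a" where
  "dual_path y w n = y - (\<Sum>k<n. w k)"

definition shift :: "(nat \<Rightarrow> 'a) \<Rightarrow> nat \<Rightarrow> 'a" where
  "shift w i = w (Suc i)"

text \<open>Indices from \<open>m\<close> on stay fixed, so this permutes all coordinates and acts
  on the whole sequence space.\<close>

definition reverse_below :: "nat \<Rightarrow> (nat \<Rightarrow> 'a) \<Rightarrow> nat \<Rightarrow> 'a" where
  "reverse_below m w i = w (if i < m then m - Suc i else i)"

lemma shift_Cons: "shift (case_nat s w) = w"
  by (simp add: shift_def fun_eq_iff)

lemma walk_path_0 [simp]: "walk_path x w 0 = x"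
  by (simp add: walk_path_def)

lemma dual_path_0 [simp]: "dual_path x w 0 = x"
  by (simp add: dual_path_def)

lemma walk_path_Suc_shift: "walk_path x w (Suc n) = walk_path (x + w 0) (shift w) n"
  unfolding walk_path_def sum.lessThan_Suc_shift by (simp add: add.assoc shift_def)

lemma dual_path_Suc_shift: "dual_path x w (Suc n) = dual_path (x - w 0) (shift w) n"
  unfolding dual_path_def sum.lessThan_Suc_shift by (simp add: algebra_simps shift_def)

text \<open>Subtracting the first \<open>i\<close> reversed increments removes the last
  \<open>i\<close> of the first \<open>m\<close> steps, so the dual path retraces the walk backwards
  from its position at time \<open>m\<close>.\<close>

lemma dual_path_reverse:
  assumes "i \<le> m"
  shows "dual_path (walk_path x w m) (reverse_below m w) i = walk_path x w (m - i)"
proof -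
  have "(\<Sum>k<i. reverse_below m w k) = (\<Sum>k\<in>{m-i..<m}. w k)"
    using assms
    by (intro sum.reindex_bij_witness[where i="\<lambda>k. m - Suc k" and j="\<lambda>k. m - Suc k"])
       (auto simp: reverse_below_def)
  moreover have "(\<Sum>k<m. w k) = (\<Sum>k<m-i. w k) + (\<Sum>k\<in>{m-i..<m}. w k)"
    by (simp add: lessThan_atLeast0 sum.atLeastLessThan_concat)
  ultimately show ?thesis
    by (simp add: walk_path_def dual_path_def)
qed

lemma measurable_walk_path [measurable]:
  "(\<lambda>p. walk_path (fst p) (snd p) n) \<in> borel_measurable
     (borel \<Otimes>\<^sub>M (\<Pi>\<^sub>M i\<in>(UNIV::nat set). (borel :: 'a::euclidean_space measure)))"
  unfolding walk_path_def by measurable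

lemma measurable_walk_path_fixed [measurable]:
  "(\<lambda>w. walk_path x w n) \<in> borel_measurable (\<Pi>\<^sub>M i\<in>(UNIV::nat set). (borel :: 'a::euclidean_space measure))"
  unfolding walk_path_def by measurable

lemma measurable_dual_path [measurable]:
  "(\<lambda>p. dual_path (fst p) (snd p) n) \<in> borel_measurable
     (borel \<Otimes>\<^sub>M (\<Pi>\<^sub>M i\<in>(UNIV::nat set). (borel :: 'a::euclidean_space measure)))"
  unfolding dual_path_def by measurable

lemma measurable_walk_path_seq [measurable]:
  "walk_path x \<in> measurable (\<Pi>\<^sub>M i\<in>(UNIV::nat set). borel) (\<Pi>\<^sub>M i\<in>(UNIV::nat set). (borel :: 'a::euclidean_space measure))"
  by (rule measurable_PiM_single') auto

lemma measurable_shift [measurable]: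
  "shift \<in> measurable (\<Pi>\<^sub>M i\<in>(UNIV::nat set). M) (\<Pi>\<^sub>M i\<in>(UNIV::nat set). M)"
  by (rule measurable_PiM_single') (auto simp: space_PiM shift_def)

lemma measurable_reverse_below [measurable]:
  "reverse_below m \<in> measurable (\<Pi>\<^sub>M i\<in>(UNIV::nat set). M) (\<Pi>\<^sub>M i\<in>(UNIV::nat set). M)"
  by (rule measurable_PiM_single') (auto simp: space_PiM reverse_below_def)

text \<open>The last conjunct excludes every earlier step from \<open>D\<close> to \<open>A\<close>,
  not just those from \<open>B1\<close> to \<open>B2\<close>: it is the first crossing as such that
  has to run between the smaller sets. \<open>D\<close> and \<open>A\<close> are separate parameters
  since reversal exchanges their roles.\<close>

definition first_crossing ::
  "'a set \<Rightarrow> 'a set \<Rightarrow> 'a set \<Rightarrow> 'a set \<Rightarrow> nat \<Rightarrow> (nat \<Rightarrow> 'a) \<Rightarrow> bool" where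
  "first_crossing D A B1 B2 k s \<longleftrightarrow>
     s k \<in> B1 \<and> s (Suc k) \<in> B2 \<and> (\<forall>j<k. \<not> (s j \<in> D \<and> s (Suc j) \<in> A))"

lemma all_less_reverse: "(\<forall>j<k. P j) \<longleftrightarrow> (\<forall>j<k. P (k - Suc j))" for k :: nat
proof (intro iffI allI impI)
  fix j assume *: "\<forall>j<k. P (k - Suc j)" "j < k"
  with *(1)[rule_format, of "k - Suc j"] show "P j"
    by (simp add: Suc_diff_Suc)
qed simp

lemma first_crossing_unique:
  assumes "B1 \<subseteq> D" "B2 \<subseteq> A" "first_crossing D A B1 B2 k s" "first_crossing D A B1 B2 l s"
  shows "k = l"
  using assms unfolding first_crossing_def by (metis linorder_neqE_nat subsetD)

lemma measure_preservingI:
  assumes T: "T \<in> measurable M M"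
    and "\<And>f. f \<in> borel_measurable M \<Longrightarrow> (\<integral>\<^sup>+x. f (T x) \<partial>M) = (\<integral>\<^sup>+x. f x \<partial>M)"
  shows "distr M M T = M"
proof (rule measure_eqI)
  fix B assume "B \<in> sets (distr M M T)"
  then have B: "B \<in> sets M" by simp
  have "emeasure (distr M M T) B = (\<integral>\<^sup>+x. indicator B x \<partial>distr M M T)"
    using B by simp
  also have "\<dots> = (\<integral>\<^sup>+x. indicator B (T x) \<partial>M)"
    using B by (intro nn_integral_distr T) auto
  also have "\<dots> = (\<integral>\<^sup>+x. indicator B x \<partial>M)"
    using B by (intro assms(2)) auto
  finally show "emeasure (distr M M T) B = emeasure M B"
    using B by simp
qed simp

section \<open>The walk under an invariant measure\<close>

lemma nn_integral_translate:
  fixes \<mu> :: "'a::euclidean_space measure"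
  assumes inv: "distr \<mu> borel (\<lambda>x. x + z) = \<mu>" and [measurable]: "f \<in> borel_measurable borel"
  shows "(\<integral>\<^sup>+x. f (x + z) \<partial>\<mu>) = (\<integral>\<^sup>+x. f x \<partial>\<mu>)"
proof -
  have [measurable_cong]: "sets \<mu> = sets borel"
    using arg_cong[OF inv, of sets] by simp
  have "(\<integral>\<^sup>+x. f (x + z) \<partial>\<mu>) = (\<integral>\<^sup>+x. f x \<partial>distr \<mu> borel (\<lambda>x. x + z))"
    by (subst nn_integral_distr) auto
  then show ?thesis using inv by simp
qed

lemma nn_integral_translate_minus:
  fixes \<mu> :: "'a::euclidean_space measure"
  assumes "distr \<mu> borel (\<lambda>x. x + z) = \<mu>" and [measurable]: "f \<in> borel_measurable borel"
  shows "(\<integral>\<^sup>+x. f (x - z) \<partial>\<mu>) = (\<integral>\<^sup>+x. f x \<partial>\<mu>)"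
  using nn_integral_translate[OF assms(1), of "\<lambda>x. f (x - z)"] by simp

text \<open>A null set \<open>C\<close> stays null under translation by almost every
  \<open>y\<close>. By Fubini, for almost every \<open>x\<close> the set of \<open>y\<close> with
  \<open>x - y\<close> in \<open>C\<close> is null, and translating by such an \<open>x\<close>
  shows that the reflection of \<open>C\<close> is null. This serves to pass from starts
  \<open>- x\<close> to starts \<open>x\<close>.\<close>

lemma AE_reflect:
  fixes \<mu> :: "'a::euclidean_space measure"
  assumes "sigma_finite_measure \<mu>" and sets_\<mu> [measurable_cong]: "sets \<mu> = sets borel"
    and trans: "AE z in \<mu>. distr \<mu> borel (\<lambda>x. x + z) = \<mu>"
    and P: "AE x in \<mu>. P x"
  shows "AE x in \<mu>. P (- x)"
proof -
  interpret sigma_finite_measure \<mu> by fact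
  interpret p: pair_sigma_finite \<mu> \<mu> by unfold_locales
  have [simp]: "space \<mu> = UNIV"
    using sets_eq_imp_space_eq[OF sets_\<mu>] by simp
  from P obtain C where C: "{x. \<not> P x} \<subseteq> C" "emeasure \<mu> C = 0" "C \<in> sets \<mu>"
    by (auto elim!: AE_E)
  then have [measurable]: "C \<in> sets borel" using sets_\<mu> by simp
  \<comment> \<open>Fubini for the indicator of \<open>x - y \<in> C\<close> replaces the inversion invariance of Haar measure.\<close>
  have "(\<integral>\<^sup>+x. \<integral>\<^sup>+y. indicator C (x - y) \<partial>\<mu> \<partial>\<mu>) = (\<integral>\<^sup>+y. \<integral>\<^sup>+x. indicator C (x - y) \<partial>\<mu> \<partial>\<mu>)"
    by (rule p.Fubini'[symmetric]) measurable
  also have "\<dots> = (\<integral>\<^sup>+y. \<integral>\<^sup>+x. indicator C x \<partial>\<mu> \<partial>\<mu>)"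
    by (rule nn_integral_cong_AE, rule AE_mp[OF trans], rule AE_I2, rule impI,
        rule nn_integral_translate_minus) auto
  also have "\<dots> = 0" using C by simp
  finally have "AE x in \<mu>. (\<integral>\<^sup>+y. indicator C (x - y) \<partial>\<mu>) = 0"
    by (subst (asm) nn_integral_0_iff_AE) auto
  with trans have ae: "AE x in \<mu>. (\<integral>\<^sup>+y. indicator C (- y) \<partial>\<mu>) = 0"
  proof eventually_elim
    case (elim x)
    then show ?case
      using nn_integral_translate[OF elim(1), of "\<lambda>y. indicator C (x - y)"] by simp
  qed
  show ?thesis
  proof (cases "(\<integral>\<^sup>+y. indicator C (- y) \<partial>\<mu>) = 0")
    case True
    then have "AE y in \<mu>. indicator C (- y) = (0::ennreal)"
      by (subst (asm) nn_integral_0_iff_AE) auto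
    then show ?thesis
      by eventually_elim (use C in \<open>auto simp: indicator_def split: if_splits\<close>)
  next
    case False
    \<comment> \<open>The integral does not depend on \<open>x\<close>, yet vanishes for almost
      every \<open>x\<close>. If it is nonzero, \<open>\<mu>\<close> is the zero measure and every
      property holds almost everywhere.\<close>
    with ae have "AE x in \<mu>. False" by simp
    then show ?thesis by eventually_elim simp
  qed
qed

text \<open>The state space is hidden: all that is kept of it is a measure on the whole vector space
  that is invariant under translation by almost every increment. Haar measure, extended by zero,
  will be the instance.\<close>

locale invariant_walk = \<mu>: sigma_finite_measure \<mu> + N: prob_space N
  for \<mu> N :: "'a::euclidean_space measure" +
  assumes sets_\<mu> [measurable_cong, simp]: "sets \<mu> = sets borel"
    and sets_N [measurable_cong, simp]: "sets N = sets borel"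
    and AE_translate: "AE z in N. distr \<mu> borel (\<lambda>x. x + z) = \<mu>"
begin

abbreviation "Q \<equiv> \<Pi>\<^sub>M i\<in>(UNIV::nat set). N"

sublocale Q: sequence_space N
  by unfold_locales

sublocale pair_sigma_finite \<mu> Q
  by unfold_locales

lemma space_\<mu> [simp]: "space \<mu> = UNIV"
  using sets_eq_imp_space_eq[OF sets_\<mu>] by simp

lemma space_N [simp]: "space N = UNIV"
  using sets_eq_imp_space_eq[OF sets_N] by simp

lemma space_Q [simp]: "space Q = UNIV"
  by (simp add: space_PiM)

lemma measurable_walk_path_Q: "walk_path x \<in> measurable Q (\<Pi>\<^sub>M i\<in>(UNIV::nat set). borel)"
  by measurable

section \<open>Transformations of start and increments that preserve the product measure\<close>

lemma translate_sum:
  assumes "\<And>i. distr \<mu> borel (\<lambda>x. x + w i) = \<mu>"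
  shows "distr \<mu> borel (\<lambda>x. x + (\<Sum>k<(n::nat). w k)) = \<mu>"
proof (induction n)
  case 0
  then show ?case by (simp add: distr_id2)
next
  case (Suc n)
  have "distr \<mu> borel (\<lambda>x. x + (\<Sum>k<Suc n. w k)) =
      distr (distr \<mu> borel (\<lambda>x. x + (\<Sum>k<n. w k))) borel (\<lambda>x. x + w n)"
    by (subst distr_distr) (auto simp: comp_def add.assoc)
  then show ?case using Suc assms by simp
qed

lemma AE_Q_translate: "AE w in Q. \<forall>i. distr \<mu> borel (\<lambda>x. x + w i) = \<mu>"
proof (subst AE_all_countable, intro allI)
  fix i :: nat
  show "AE w in Q. distr \<mu> borel (\<lambda>x. x + w i) = \<mu>"
  proof (rule AE_distrD[where M' = N and f = "\<lambda>w. w i"])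
    show "AE z in distr Q N (\<lambda>w. w i). distr \<mu> borel (\<lambda>x. x + z) = \<mu>"
      using AE_translate unfolding Q.PiM_component[OF UNIV_I] .
  qed simp
qed

text \<open>The Markov property at the first step: the first increment is independent of the others,
  which again have law \<open>Q\<close>.\<close>

lemma nn_integral_Q_shift:
  assumes [measurable]: "f \<in> borel_measurable (N \<Otimes>\<^sub>M Q)"
  shows "(\<integral>\<^sup>+w. f (w 0, shift w) \<partial>Q) = (\<integral>\<^sup>+s. \<integral>\<^sup>+w. f (s, w) \<partial>Q \<partial>N)"
proof -
  have "(\<integral>\<^sup>+w. f (w 0, shift w) \<partial>Q) =
      (\<integral>\<^sup>+w. f (w 0, shift w) \<partial>distr (N \<Otimes>\<^sub>M Q) Q (\<lambda>(s, w). case_nat s w))"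
    by (simp add: Q.PiM_iter)
  also have "\<dots> = (\<integral>\<^sup>+p. f p \<partial>(N \<Otimes>\<^sub>M Q))"
    by (subst nn_integral_distr) (simp_all add: split_beta shift_Cons)
  also have "\<dots> = (\<integral>\<^sup>+s. \<integral>\<^sup>+w. f (s, w) \<partial>Q \<partial>N)"
    by (rule Q.nn_integral_fst[symmetric]) measurable
  finally show ?thesis .
qed

text \<open>Permuting coordinates does not change the law of an i.i.d. sequence.\<close>

lemma nn_integral_Q_reverse:
  assumes [measurable]: "f \<in> borel_measurable Q"
  shows "(\<integral>\<^sup>+w. f (reverse_below m w) \<partial>Q) = (\<integral>\<^sup>+w. f w \<partial>Q)"
proof -
  have "distr Q Q (reverse_below m) = Q"
    unfolding reverse_below_def[abs_def]
    using distr_PiM_reindex[of UNIV "\<lambda>_. N" "\<lambda>i. if i < m then m - Suc i else i" UNIV]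
    unfolding restrict_UNIV
    by (rule meta_mp) (auto simp: inj_on_def N.prob_space_axioms split: if_splits)
  then have "(\<integral>\<^sup>+w. f w \<partial>Q) = (\<integral>\<^sup>+w. f w \<partial>distr Q Q (reverse_below m))"
    by simp
  also have "\<dots> = (\<integral>\<^sup>+w. f (reverse_below m w) \<partial>Q)"
    by (subst nn_integral_distr) auto
  finally show ?thesis ..
qed

text \<open>For almost every value of the first increment the start is merely translated, which
  \<open>\<mu>\<close> does not notice, and the remaining increments again have law
  \<open>Q\<close>.\<close>

lemma distr_dual_shift:
  "distr (\<mu> \<Otimes>\<^sub>M Q) (\<mu> \<Otimes>\<^sub>M Q) (\<lambda>p. (fst p - snd p 0, shift (snd p))) = \<mu> \<Otimes>\<^sub>M Q"
proof (rule measure_preservingI)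
  show "(\<lambda>p. (fst p - snd p 0, shift (snd p))) \<in> measurable (\<mu> \<Otimes>\<^sub>M Q) (\<mu> \<Otimes>\<^sub>M Q)"
    by measurable
  fix f :: "'a \<times> (nat \<Rightarrow> 'a) \<Rightarrow> ennreal"
  assume [measurable]: "f \<in> borel_measurable (\<mu> \<Otimes>\<^sub>M Q)"
  have "(\<integral>\<^sup>+p. f (fst p - snd p 0, shift (snd p)) \<partial>(\<mu> \<Otimes>\<^sub>M Q)) =
      (\<integral>\<^sup>+x. \<integral>\<^sup>+w. f (x - w 0, shift w) \<partial>Q \<partial>\<mu>)"
    by (subst Q.nn_integral_fst[symmetric]) simp_all
  also have "\<dots> = (\<integral>\<^sup>+x. \<integral>\<^sup>+s. \<integral>\<^sup>+w. f (x - s, w) \<partial>Q \<partial>N \<partial>\<mu>)"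
    using nn_integral_Q_shift[of "\<lambda>p. f (x - fst p, snd p)" for x] by simp
  also have "\<dots> = (\<integral>\<^sup>+s. \<integral>\<^sup>+x. \<integral>\<^sup>+w. f (x - s, w) \<partial>Q \<partial>\<mu> \<partial>N)"
  proof -
    interpret p: pair_sigma_finite \<mu> N by unfold_locales
    show ?thesis by (rule p.Fubini'[symmetric]) measurable
  qed
  also have "\<dots> = (\<integral>\<^sup>+s. \<integral>\<^sup>+x. \<integral>\<^sup>+w. f (x, w) \<partial>Q \<partial>\<mu> \<partial>N)"
    by (rule nn_integral_cong_AE, rule AE_mp[OF AE_translate], rule AE_I2, rule impI)
       (rule nn_integral_translate_minus[where f = "\<lambda>x. \<integral>\<^sup>+w. f (x, w) \<partial>Q"]; measurable)
  also have "\<dots> = (\<integral>\<^sup>+p. f p \<partial>(\<mu> \<Otimes>\<^sub>M Q))"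
    by (simp add: Q.nn_integral_fst N.emeasure_space_1[simplified])
  finally show "(\<integral>\<^sup>+p. f (fst p - snd p 0, shift (snd p)) \<partial>(\<mu> \<Otimes>\<^sub>M Q)) =
      (\<integral>\<^sup>+p. f p \<partial>(\<mu> \<Otimes>\<^sub>M Q))" .
qed

text \<open>Integrate over the start first, with the increments fixed: the endpoint is a translate
  of the start, so \<open>\<mu>\<close> absorbs the displacement. What is left is the invariance of
  \<open>Q\<close> under reversal.\<close>

lemma distr_reverse:
  "distr (\<mu> \<Otimes>\<^sub>M Q) (\<mu> \<Otimes>\<^sub>M Q)
     (\<lambda>p. (walk_path (fst p) (snd p) m, reverse_below m (snd p))) = \<mu> \<Otimes>\<^sub>M Q"
proof (rule measure_preservingI)
  show "(\<lambda>p. (walk_path (fst p) (snd p) m, reverse_below m (snd p))) \<in>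
      measurable (\<mu> \<Otimes>\<^sub>M Q) (\<mu> \<Otimes>\<^sub>M Q)"
    by measurable
  fix f :: "'a \<times> (nat \<Rightarrow> 'a) \<Rightarrow> ennreal"
  assume [measurable]: "f \<in> borel_measurable (\<mu> \<Otimes>\<^sub>M Q)"
  have "(\<integral>\<^sup>+p. f (walk_path (fst p) (snd p) m, reverse_below m (snd p)) \<partial>(\<mu> \<Otimes>\<^sub>M Q)) =
      (\<integral>\<^sup>+w. \<integral>\<^sup>+x. f (walk_path x w m, reverse_below m w) \<partial>\<mu> \<partial>Q)"
    by (subst nn_integral_snd[symmetric]) simp_all
  also have "\<dots> = (\<integral>\<^sup>+w. \<integral>\<^sup>+x. f (x, reverse_below m w) \<partial>\<mu> \<partial>Q)"
    unfolding walk_path_def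
    by (rule nn_integral_cong_AE, rule AE_mp[OF AE_Q_translate], rule AE_I2, rule impI,
        rule nn_integral_translate[OF translate_sum, where f = "\<lambda>x. f (x, v)" for v])
       auto
  also have "\<dots> = (\<integral>\<^sup>+w. \<integral>\<^sup>+x. f (x, w) \<partial>\<mu> \<partial>Q)"
    by (rule nn_integral_Q_reverse[of "\<lambda>w. \<integral>\<^sup>+x. f (x, w) \<partial>\<mu>"]) measurable
  also have "\<dots> = (\<integral>\<^sup>+p. f p \<partial>(\<mu> \<Otimes>\<^sub>M Q))"
    by (rule nn_integral_snd) measurable
  finally show "(\<integral>\<^sup>+p. f (walk_path (fst p) (snd p) m, reverse_below m (snd p)) \<partial>(\<mu> \<Otimes>\<^sub>M Q)) =
      (\<integral>\<^sup>+p. f p \<partial>(\<mu> \<Otimes>\<^sub>M Q))" .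
qed

lemma emeasure_reverse:
  assumes "B \<in> sets (\<mu> \<Otimes>\<^sub>M Q)"
  shows "emeasure (\<mu> \<Otimes>\<^sub>M Q) {p. (walk_path (fst p) (snd p) m, reverse_below m (snd p)) \<in> B} =
    emeasure (\<mu> \<Otimes>\<^sub>M Q) B"
proof -
  have "emeasure (distr (\<mu> \<Otimes>\<^sub>M Q) (\<mu> \<Otimes>\<^sub>M Q)
      (\<lambda>p. (walk_path (fst p) (snd p) m, reverse_below m (snd p)))) B =
     emeasure (\<mu> \<Otimes>\<^sub>M Q) {p. (walk_path (fst p) (snd p) m, reverse_below m (snd p)) \<in> B}"
    using assms by (subst emeasure_distr) (simp_all add: vimage_def space_pair_measure)
  then show ?thesis by (simp add: distr_reverse)
qed

section \<open>Almost sure crossings of the dual path\<close>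

lemma AE_dual_tail:
  assumes "AE p in \<mu> \<Otimes>\<^sub>M Q. P (dual_path (fst p) (snd p))"
  shows "AE p in \<mu> \<Otimes>\<^sub>M Q. \<forall>m. P (\<lambda>i. dual_path (fst p) (snd p) (m + i))"
proof (subst AE_all_countable, intro allI)
  fix m
  show "AE p in \<mu> \<Otimes>\<^sub>M Q. P (\<lambda>i. dual_path (fst p) (snd p) (m + i))"
  proof (induction m)
    case 0
    then show ?case using assms by simp
  next
    case (Suc m)
    \<comment> \<open>One dual step preserves the measure, so an almost sure property also holds
      almost surely after that step.\<close>
    then have "AE p in distr (\<mu> \<Otimes>\<^sub>M Q) (\<mu> \<Otimes>\<^sub>M Q) (\<lambda>p. (fst p - snd p 0, shift (snd p))).
        P (\<lambda>i. dual_path (fst p) (snd p) (m + i))"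
      by (simp only: distr_dual_shift)
    from AE_distrD[OF _ this] show ?case
      by (simp add: dual_path_Suc_shift)
  qed
qed

text \<open>Applied to tails, the hypotheses say that a visit to \<open>A\<close> is followed by a
  later visit to \<open>D\<close> and that the path never leaves \<open>A \<union> D\<close>.
  Getting from one visit to the other then takes a single step from \<open>A\<close> to
  \<open>D\<close>.\<close>

lemma AE_dual_transition:
  assumes "AE p in \<mu> \<Otimes>\<^sub>M Q. \<exists>n\<ge>1. dual_path (fst p) (snd p) n \<in> A"
    and "AE p in \<mu> \<Otimes>\<^sub>M Q. \<exists>n\<ge>1. dual_path (fst p) (snd p) n \<in> D"
    and "AE p in \<mu> \<Otimes>\<^sub>M Q. dual_path (fst p) (snd p) 0 \<in> A \<union> D"
  shows "AE p in \<mu> \<Otimes>\<^sub>M Q. \<exists>n\<ge>1. dual_path (fst p) (snd p) n \<in> A \<and> dual_path (fst p) (snd p) (Suc n) \<in> D"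
  using assms[THEN AE_dual_tail]
proof eventually_elim
  case (elim p)
  let ?y = "dual_path (fst p) (snd p)"
  from elim(1)[rule_format, of 0] obtain a where a: "a \<ge> 1" "?y a \<in> A" by auto
  from elim(2)[rule_format, of a] obtain b where b: "b \<ge> 1" "?y (a + b) \<in> D" by auto
  have "\<exists>n. a \<le> n \<and> ?y n \<in> A \<and> ?y (Suc n) \<in> D"
  proof (rule ccontr)
    assume neg: "\<not> ?thesis"
    \<comment> \<open>Without such a step the path would stay in \<open>A\<close> and avoid
      \<open>D\<close> at all later times, against its visit to \<open>D\<close> at time
      \<open>a + b\<close>.\<close>
    have "?y (a + i) \<in> A \<and> ?y (a + Suc i) \<notin> D" for i
    proof (induction i)
      case 0
      from a neg show ?case by auto
    next
      case (Suc i)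
      then have "?y (a + Suc i) \<in> A"
        using elim(3)[rule_format, of "a + Suc i"] by auto
      moreover have "?y (a + Suc (Suc i)) \<notin> D"
        using neg calculation by (metis add_Suc_right le_add1)
      ultimately show ?case ..
    qed
    from this[of "b - 1"] b show False by simp
  qed
  with a show ?case by (metis le_trans)
qed

lemma space_pair [simp]: "space (\<mu> \<Otimes>\<^sub>M Q) = UNIV"
  by (simp add: space_pair_measure)

text \<open>Split the left side by the time \<open>k\<close> of the next crossing and reverse each
  piece at the end of that crossing. The pieces become dual paths that step from \<open>B2\<close>
  to \<open>B1\<close> and then first cross from \<open>A\<close> to \<open>D\<close> at
  \<open>k\<close>. Summed over \<open>k\<close>, the condition on the later crossing disappears
  almost surely.\<close>

lemma crossing_flux:
  assumes [measurable]: "A \<in> sets borel" "D \<in> sets borel" "B1 \<in> sets borel" "B2 \<in> sets borel"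
    and sub: "B1 \<subseteq> D" "B2 \<subseteq> A"
    and trans: "AE p in \<mu> \<Otimes>\<^sub>M Q.
      \<exists>n\<ge>1. dual_path (fst p) (snd p) n \<in> A \<and> dual_path (fst p) (snd p) (Suc n) \<in> D"
  shows "emeasure (\<mu> \<Otimes>\<^sub>M Q) {p. fst p \<in> D \<and> walk_path (fst p) (snd p) 1 \<in> A \<and>
      (\<exists>k. first_crossing D A B1 B2 k (\<lambda>i. walk_path (fst p) (snd p) (Suc i)))} =
    emeasure (\<mu> \<Otimes>\<^sub>M Q) {p. fst p \<in> B1 \<and> walk_path (fst p) (snd p) 1 \<in> B2}"
    (is "emeasure ?\<Pi> ?L = emeasure ?\<Pi> ?R")
proof -
  define F where "F k = {p \<in> space ?\<Pi>. fst p \<in> D \<and> walk_path (fst p) (snd p) 1 \<in> A \<and>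
    first_crossing D A B1 B2 k (\<lambda>i. walk_path (fst p) (snd p) (Suc i))}" for k
  define G where "G k = {p \<in> space ?\<Pi>. dual_path (fst p) (snd p) 0 \<in> B2 \<and>
    dual_path (fst p) (snd p) 1 \<in> B1 \<and>
    first_crossing A D A D k (\<lambda>i. dual_path (fst p) (snd p) (Suc i))}" for k
  define E where "E = {p \<in> space ?\<Pi>. dual_path (fst p) (snd p) 0 \<in> B2 \<and>
    dual_path (fst p) (snd p) 1 \<in> B1}"
  have sets_G [measurable]: "G k \<in> sets ?\<Pi>" for k
    unfolding G_def first_crossing_def by measurable
  have sets_F: "F k \<in> sets ?\<Pi>" for k
    unfolding F_def first_crossing_def by measurable
  have [measurable]: "E \<in> sets ?\<Pi>"
    unfolding E_def by measurable
  have "emeasure ?\<Pi> (F k) = emeasure ?\<Pi> (G k)" for k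
  proof -
    \<comment> \<open>The shifted path has its crossing at \<open>k\<close>, so the walk makes it
      between times \<open>k + 1\<close> and \<open>k + 2\<close>. Reversal at \<open>k + 2\<close>
      makes it the first dual step, while the initial step from \<open>D\<close> to \<open>A\<close>
      becomes the dual step from \<open>A\<close> to \<open>D\<close> between \<open>k + 1\<close>
      and \<open>k + 2\<close>.\<close>
    have "F k = {p. (walk_path (fst p) (snd p) (k + 2), reverse_below (k + 2) (snd p)) \<in> G k}"
    proof (intro set_eqI)
      fix p :: "'a \<times> (nat \<Rightarrow> 'a)"
      let ?y = "dual_path (walk_path (fst p) (snd p) (k + 2)) (reverse_below (k + 2) (snd p))"
      have y: "?y i = walk_path (fst p) (snd p) (k + 2 - i)" if "i \<le> k + 2" for i
        using that by (rule dual_path_reverse)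
      \<comment> \<open>The steps strictly between the two crossings are traversed in the opposite
        order and direction: having none from \<open>D\<close> to \<open>A\<close> means having no
        dual step from \<open>A\<close> to \<open>D\<close>.\<close>
      have "(\<forall>j<k. \<not> (walk_path (fst p) (snd p) (Suc j) \<in> D \<and> walk_path (fst p) (snd p) (Suc (Suc j)) \<in> A))
        \<longleftrightarrow> (\<forall>j<k. \<not> (?y (Suc j) \<in> A \<and> ?y (Suc (Suc j)) \<in> D))" (is "?lhs \<longleftrightarrow> ?rhs")
      proof -
        have "?lhs \<longleftrightarrow> (\<forall>j<k. \<not> (walk_path (fst p) (snd p) (Suc (k - Suc j)) \<in> D \<and>
            walk_path (fst p) (snd p) (Suc (Suc (k - Suc j))) \<in> A))"
          by (rule all_less_reverse)
        also have "\<dots> \<longleftrightarrow> ?rhs"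
        proof (intro all_cong)
          fix j assume "j < k"
          then show "(\<not> (walk_path (fst p) (snd p) (Suc (k - Suc j)) \<in> D \<and>
              walk_path (fst p) (snd p) (Suc (Suc (k - Suc j))) \<in> A)) \<longleftrightarrow>
            (\<not> (?y (Suc j) \<in> A \<and> ?y (Suc (Suc j)) \<in> D))"
            using y[of "Suc j"] y[of "Suc (Suc j)"]
            by (auto simp: Suc_diff_Suc Suc_diff_le)
        qed
        finally show ?thesis .
      qed
      then show "p \<in> F k \<longleftrightarrow>
          p \<in> {p. (walk_path (fst p) (snd p) (k + 2), reverse_below (k + 2) (snd p)) \<in> G k}"
        unfolding F_def G_def first_crossing_def using y[of 0] y[of 1] y[of "k + 1"] y[of "k + 2"]
        by auto
    qed
    then show ?thesis using emeasure_reverse[OF sets_G, of "k + 2" k] by simp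
  qed
  then have eq: "(\<lambda>k. emeasure ?\<Pi> (F k)) = (\<lambda>k. emeasure ?\<Pi> (G k))" by (rule ext)
  \<comment> \<open>A path has at most one first crossing, so the measures of the pieces may be
    added up.\<close>
  have disj: "disjoint_family F" "disjoint_family G"
    using sub unfolding disjoint_family_on_def F_def G_def
    by (auto dest: first_crossing_unique[rotated 2])
  have "emeasure ?\<Pi> (\<Union>k. F k) = (\<Sum>k. emeasure ?\<Pi> (F k))"
    using sets_F by (intro suminf_emeasure[symmetric] disj) blast
  also have "\<dots> = emeasure ?\<Pi> (\<Union>k. G k)"
    unfolding eq using sets_G by (intro suminf_emeasure disj) blast
  finally have "emeasure ?\<Pi> (\<Union>k. F k) = emeasure ?\<Pi> (\<Union>k. G k)" .
  also have "\<dots> = emeasure ?\<Pi> E"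
  proof (rule emeasure_eq_AE)
    \<comment> \<open>Recurrence enters here: almost every dual path crosses from \<open>A\<close>
      to \<open>D\<close> after its first step, and the least such time selects the piece that
      contains it.\<close>
    show "AE p in ?\<Pi>. p \<in> (\<Union>k. G k) \<longleftrightarrow> p \<in> E"
      using trans
    proof eventually_elim
      case (elim p)
      let ?P = "\<lambda>k. dual_path (fst p) (snd p) (Suc k) \<in> A \<and> dual_path (fst p) (snd p) (Suc (Suc k)) \<in> D"
      from elim have "\<exists>k. ?P k"
        by (auto simp: Suc_le_eq gr0_conv_Suc)
      then obtain k where "?P k" "\<forall>j<k. \<not> ?P j"
        unfolding exists_least_iff[of ?P] by blast
      then show ?case by (auto simp: E_def G_def first_crossing_def)
    qed
  qed measurable
  \<comment> \<open>Reversal at time 1 turns the dual step from \<open>B2\<close> to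
    \<open>B1\<close> back into a walk step from \<open>B1\<close> to \<open>B2\<close>.\<close>
  also have "\<dots> = emeasure ?\<Pi> {p. (walk_path (fst p) (snd p) 1, reverse_below 1 (snd p)) \<in> E}"
    by (rule emeasure_reverse[symmetric]) measurable
  also have "{p. (walk_path (fst p) (snd p) 1, reverse_below 1 (snd p)) \<in> E} = ?R"
    by (auto simp: E_def dual_path_reverse[of 1 1, simplified])
  also have "(\<Union>k. F k) = ?L"
    by (auto simp: F_def)
  finally show ?thesis .
qed

section \<open>Flux of single steps and crossing probabilities\<close>

lemma nn_integral_step_duality:
  assumes [measurable]: "D \<in> sets borel" "g \<in> borel_measurable borel"
  shows "(\<integral>\<^sup>+x. indicator D x * (\<integral>\<^sup>+s. g (x + s) \<partial>N) \<partial>\<mu>) = (\<integral>\<^sup>+y. g y * emeasure N {s. y - s \<in> D} \<partial>\<mu>)"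
proof -
  interpret p: pair_sigma_finite \<mu> N by unfold_locales
  \<comment> \<open>Writing \<open>x\<close> as \<open>x + s - s\<close> makes the integrand, for
    fixed \<open>s\<close>, a function of \<open>x + s\<close> alone, so that the translation by
    \<open>s\<close> can be removed.\<close>
  have "(\<integral>\<^sup>+x. indicator D x * (\<integral>\<^sup>+s. g (x + s) \<partial>N) \<partial>\<mu>) =
      (\<integral>\<^sup>+x. \<integral>\<^sup>+s. indicator D (x + s - s) * g (x + s) \<partial>N \<partial>\<mu>)"
    by (simp add: nn_integral_cmult)
  also have "\<dots> = (\<integral>\<^sup>+s. \<integral>\<^sup>+x. indicator D (x + s - s) * g (x + s) \<partial>\<mu> \<partial>N)"
    by (rule p.Fubini'[symmetric]) measurable
  also have "\<dots> = (\<integral>\<^sup>+s. \<integral>\<^sup>+y. indicator D (y - s) * g y \<partial>\<mu> \<partial>N)"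
    by (rule nn_integral_cong_AE, rule AE_mp[OF AE_translate], rule AE_I2, rule impI,
        rule nn_integral_translate[where f = "\<lambda>y. indicator D (y - s) * g y" for s])
       auto
  also have "\<dots> = (\<integral>\<^sup>+y. \<integral>\<^sup>+s. g y * indicator {s. y - s \<in> D} s \<partial>N \<partial>\<mu>)"
    by (subst p.Fubini') (auto intro!: nn_integral_cong simp: indicator_def)
  also have "\<dots> = (\<integral>\<^sup>+y. g y * emeasure N {s. y - s \<in> D} \<partial>\<mu>)"
    by (auto intro!: nn_integral_cong simp: nn_integral_cmult)
  finally show ?thesis .
qed

text \<open>With \<open>B1 = D\<close> this will be the entrance kernel. With \<open>B2 = A\<close>
  it is the law of the exit position for the walk started at \<open>z\<close>, which the exit kernel
  averages over the first step into \<open>A\<close>.\<close>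

definition crossing_prob :: "'a set \<Rightarrow> 'a set \<Rightarrow> 'a set \<Rightarrow> 'a set \<Rightarrow> 'a \<Rightarrow> ennreal" where
  "crossing_prob D A B1 B2 z = emeasure Q {w. \<exists>k. first_crossing D A B1 B2 k (walk_path z w)}"

lemma sets_first_crossing:
  assumes [measurable]: "A \<in> sets borel" "D \<in> sets borel" "B1 \<in> sets borel" "B2 \<in> sets borel"
  shows "{p \<in> space (borel \<Otimes>\<^sub>M Q). \<exists>k. first_crossing D A B1 B2 k (walk_path (fst p) (snd p))} \<in> sets (borel \<Otimes>\<^sub>M Q)"
  unfolding first_crossing_def by measurable

lemma measurable_crossing_prob [measurable]:
  assumes [measurable]: "A \<in> sets borel" "D \<in> sets borel" "B1 \<in> sets borel" "B2 \<in> sets borel"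
  shows "crossing_prob D A B1 B2 \<in> borel_measurable borel"
  using Q.measurable_emeasure_Pair[OF sets_first_crossing[OF assms]]
  by (simp add: crossing_prob_def[abs_def] vimage_def space_pair_measure)

text \<open>This is \<open>crossing_flux\<close> with the first increment split off by the Markov
  property, so that the next crossing is seen from the point \<open>x + s\<close> of
  \<open>A\<close> just entered.\<close>

lemma crossing_prob_balance:
  assumes [measurable]: "A \<in> sets borel" "D \<in> sets borel" "B1 \<in> sets borel" "B2 \<in> sets borel"
    and sub: "B1 \<subseteq> D" "B2 \<subseteq> A"
    and trans: "AE p in \<mu> \<Otimes>\<^sub>M Q.
      \<exists>n\<ge>1. dual_path (fst p) (snd p) n \<in> A \<and> dual_path (fst p) (snd p) (Suc n) \<in> D"
  shows "(\<integral>\<^sup>+x. indicator D x * (\<integral>\<^sup>+s. indicator A (x + s) * crossing_prob D A B1 B2 (x + s) \<partial>N) \<partial>\<mu>) =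
    (\<integral>\<^sup>+x. indicator B1 x * (\<integral>\<^sup>+s. indicator B2 (x + s) \<partial>N) \<partial>\<mu>)"
proof -
  let ?L = "{p \<in> space (\<mu> \<Otimes>\<^sub>M Q). fst p \<in> D \<and> walk_path (fst p) (snd p) 1 \<in> A \<and>
      (\<exists>k. first_crossing D A B1 B2 k (\<lambda>i. walk_path (fst p) (snd p) (Suc i)))}"
  let ?R = "{p \<in> space (\<mu> \<Otimes>\<^sub>M Q). fst p \<in> B1 \<and> walk_path (fst p) (snd p) 1 \<in> B2}"
  have [measurable]: "?L \<in> sets (\<mu> \<Otimes>\<^sub>M Q)" "?R \<in> sets (\<mu> \<Otimes>\<^sub>M Q)"
    unfolding first_crossing_def by measurable
  let ?E = "{p \<in> space (borel \<Otimes>\<^sub>M Q). \<exists>k. first_crossing D A B1 B2 k (walk_path (fst p) (snd p))}"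
  have [measurable]: "?E \<in> sets (borel \<Otimes>\<^sub>M Q)"
    by (rule sets_first_crossing) measurable
  have "(\<integral>\<^sup>+x. indicator D x * (\<integral>\<^sup>+s. indicator A (x + s) * crossing_prob D A B1 B2 (x + s) \<partial>N) \<partial>\<mu>) =
      (\<integral>\<^sup>+x. \<integral>\<^sup>+s. \<integral>\<^sup>+w. indicator D x * (indicator A (x + s) * indicator ?E (x + s, w)) \<partial>Q \<partial>N \<partial>\<mu>)"
  proof -
    have "crossing_prob D A B1 B2 z = (\<integral>\<^sup>+w. indicator ?E (z, w) \<partial>Q)" for z
    proof -
      have "(\<integral>\<^sup>+w. indicator ?E (z, w) \<partial>Q) = (\<integral>\<^sup>+w. indicator (Pair z -` ?E) w \<partial>Q)"
        by (auto intro!: nn_integral_cong simp: indicator_def)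
      also have "\<dots> = emeasure Q (Pair z -` ?E)"
        by (intro nn_integral_indicator sets_Pair1) measurable
      finally show ?thesis by (simp add: crossing_prob_def space_pair_measure vimage_def)
    qed
    then show ?thesis by (simp add: nn_integral_cmult)
  qed
  also have "\<dots> = (\<integral>\<^sup>+x. \<integral>\<^sup>+w. indicator D x * (indicator A (x + w 0) * indicator ?E (x + w 0, shift w)) \<partial>Q \<partial>\<mu>)"
    using nn_integral_Q_shift[of "\<lambda>p. indicator D x * (indicator A (x + fst p) * indicator ?E (x + fst p, snd p))" for x]
    by simp
  also have "\<dots> = (\<integral>\<^sup>+p. indicator ?L p \<partial>(\<mu> \<Otimes>\<^sub>M Q))"
    by (subst Q.nn_integral_fst[symmetric], measurable)
       (auto intro!: nn_integral_cong simp: indicator_def walk_path_Suc_shift space_pair_measure first_crossing_def)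
  also have "\<dots> = emeasure (\<mu> \<Otimes>\<^sub>M Q) ?L"
    by (rule nn_integral_indicator) measurable
  also have "\<dots> = emeasure (\<mu> \<Otimes>\<^sub>M Q) ?R"
    using crossing_flux[OF assms] by simp
  also have "\<dots> = (\<integral>\<^sup>+p. indicator ?R p \<partial>(\<mu> \<Otimes>\<^sub>M Q))"
    by (rule nn_integral_indicator[symmetric]) measurable
  also have "\<dots> = (\<integral>\<^sup>+x. \<integral>\<^sup>+w. indicator B1 x * indicator B2 (x + w 0) \<partial>Q \<partial>\<mu>)"
    by (subst Q.nn_integral_fst[symmetric], measurable)
       (auto intro!: nn_integral_cong simp: indicator_def walk_path_Suc_shift space_pair_measure)
  also have "\<dots> = (\<integral>\<^sup>+x. indicator B1 x * (\<integral>\<^sup>+s. indicator B2 (x + s) \<partial>N) \<partial>\<mu>)"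
    using nn_integral_Q_shift[of "\<lambda>p. indicator B1 x * indicator B2 (x + fst p)" for x]
    by (simp add: nn_integral_cmult Q.emeasure_space_1[simplified])
  finally show ?thesis .
qed

end

section \<open>Haar measure on the state space and the path law\<close>

text \<open>By second countability, the complement of the support is covered by countably many basic
  open sets of measure zero.\<close>

lemma AE_top_support:
  fixes \<mu> :: "'a::second_countable_topology measure"
  assumes sets: "sets \<mu> = sets borel"
  shows "AE x in \<mu>. x \<in> top_support \<mu>"
proof -
  obtain B :: "'a set set" where B: "countable B" "topological_basis B"
    using ex_countable_basis by blast
  have "AE x in \<mu>. \<forall>b\<in>{b\<in>B. emeasure \<mu> b = 0}. x \<notin> b"
  proof (subst AE_ball_countable)
    show "countable {b\<in>B. emeasure \<mu> b = 0}" using B(1) by simp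
    show "\<forall>b\<in>{b\<in>B. emeasure \<mu> b = 0}. AE x in \<mu>. x \<notin> b"
      using B(2) sets by (auto intro!: AE_not_in null_setsI dest: topological_basis_open)
  qed
  then show ?thesis
  proof eventually_elim
    case (elim x)
    show ?case unfolding top_support_def
    proof (intro CollectI allI impI)
      fix U :: "'a set" assume U: "open U" "x \<in> U"
      then obtain b where b: "b \<in> B" "x \<in> b" "b \<subseteq> U"
        using topological_basisE[OF B(2)] by metis
      then have "0 < emeasure \<mu> b" using elim by (auto simp: zero_less_iff_neq_zero)
      also have "\<dots> \<le> emeasure \<mu> U" using b U sets by (intro emeasure_mono) auto
      finally show "emeasure \<mu> U > 0" .
    qed
  qed
qed

lemma closed_state_space: "closed (state_space M X)"
  unfolding state_space_def hull_def by (intro closed_Inter) auto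

lemma add_subgroup_state_space: "add_subgroup (state_space M X)"
  unfolding state_space_def hull_def add_subgroup_def by blast

section \<open>Entrance and exit times as first crossings\<close>

lemma Inf_enat_eq_iff: "Inf T = enat m \<longleftrightarrow> enat m \<in> T \<and> (\<forall>n<m. enat n \<notin> T)"
proof
  assume eq: "Inf T = enat m"
  then have "T \<noteq> {}" by (auto simp: Inf_enat_def)
  then have "Inf T \<in> T" unfolding Inf_enat_def by (auto intro: LeastI)
  moreover have "enat n \<notin> T" if "n < m" for n
    using Inf_lower[of "enat n" T] eq that by auto
  ultimately show "enat m \<in> T \<and> (\<forall>n<m. enat n \<notin> T)" using eq by simp
next
  assume *: "enat m \<in> T \<and> (\<forall>n<m. enat n \<notin> T)"
  show "Inf T = enat m"
  proof (rule antisym)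
    show "Inf T \<le> enat m" using * by (intro Inf_lower) simp
    have "enat m \<le> t" if "t \<in> T" for t using * that by (cases t) (auto simp: not_less[symmetric])
    then show "enat m \<le> Inf T" by (rule Inf_greatest)
  qed
qed

text \<open>\<open>first_crossing\<close> records the time just before the step into
  \<open>A\<close>, one less than the entrance time. The entrance time has to exceed 0, so the
  truncated difference \<open>k - 1\<close> is harmless.\<close>

lemma entrance_time_1_eq_iff:
  "entrance_time Z A s 1 = enat m \<longleftrightarrow> (\<exists>k. m = Suc k \<and> first_crossing (Z - A) A (Z - A) A k s)"
proof -
  have "entrance_time Z A s 1 = enat m \<longleftrightarrow>
      0 < m \<and> s (m - 1) \<in> Z - A \<and> s m \<in> A \<and> (\<forall>n<m. \<not> (0 < n \<and> s (n - 1) \<in> Z - A \<and> s n \<in> A))"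
    unfolding One_nat_def entrance_time.simps Inf_enat_eq_iff by (auto simp: zero_enat_def)
  also have "\<dots> \<longleftrightarrow> (\<exists>k. m = Suc k \<and> first_crossing (Z - A) A (Z - A) A k s)"
    by (cases m) (auto simp: first_crossing_def less_Suc_eq_0_disj)
  finally show ?thesis .
qed

lemma entrance_chain_1_iff:
  assumes "B \<subseteq> A"
  shows "entrance_chain Z A s 1 \<in> Some ` B \<longleftrightarrow> (\<exists>k. first_crossing (Z - A) A (Z - A) B k s)"
proof -
  have "entrance_chain Z A s 1 \<in> Some ` B \<longleftrightarrow> (\<exists>m. entrance_time Z A s 1 = enat m \<and> s m \<in> B)"
    by (cases "entrance_time Z A s 1") (auto simp: entrance_chain_def at_time_def)
  also have "\<dots> \<longleftrightarrow> (\<exists>k. first_crossing (Z - A) A (Z - A) B k s)"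
    using assms unfolding entrance_time_1_eq_iff first_crossing_def by auto
  finally show ?thesis .
qed

lemma exit_chain_1_iff:
  assumes "B \<subseteq> Z - A"
  shows "exit_chain Z A s 1 \<in> Some ` B \<longleftrightarrow> (\<exists>k. first_crossing (Z - A) A B A k s)"
proof -
  have "exit_chain Z A s 1 \<in> Some ` B \<longleftrightarrow> (\<exists>m. entrance_time Z A s 1 = enat m \<and> s (m - 1) \<in> B)"
    by (cases "entrance_time Z A s 1") (auto simp: exit_chain_def at_time_def one_enat_def)
  also have "\<dots> \<longleftrightarrow> (\<exists>k. first_crossing (Z - A) A (Z - A) A k s \<and> s k \<in> B)"
    unfolding entrance_time_1_eq_iff by auto
  also have "\<dots> \<longleftrightarrow> (\<exists>k. first_crossing (Z - A) A B A k s)"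
    using assms unfolding first_crossing_def by blast
  finally show ?thesis .
qed

lemma hitting_time_finite_iff: "hitting_time B s < \<infinity> \<longleftrightarrow> (\<exists>n\<ge>1. s n \<in> B)"
  unfolding hitting_time_def Inf_less_iff by auto

lemma sets_crossing_paths [measurable]:
  assumes [measurable]: "A \<in> sets borel" "D \<in> sets borel" "B1 \<in> sets borel" "B2 \<in> sets borel"
  shows "{s. \<exists>k. first_crossing D A B1 B2 k s} \<in> sets (\<Pi>\<^sub>M i\<in>(UNIV::nat set). (borel :: 'a::euclidean_space measure))"
proof -
  have "{s \<in> space (\<Pi>\<^sub>M i\<in>(UNIV::nat set). (borel :: 'a measure)). \<exists>k. first_crossing D A B1 B2 k s}
      \<in> sets (\<Pi>\<^sub>M i\<in>(UNIV::nat set). borel)"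
    unfolding first_crossing_def by measurable
  then show ?thesis by (simp add: space_PiM)
qed

lemma sets_hitting_paths [measurable]:
  assumes [measurable]: "B \<in> sets borel"
  shows "{s. \<exists>n\<ge>1. s n \<in> B} \<in> sets (\<Pi>\<^sub>M i\<in>(UNIV::nat set). (borel :: 'a::euclidean_space measure))"
proof -
  have "{s \<in> space (\<Pi>\<^sub>M i\<in>(UNIV::nat set). (borel :: 'a measure)). \<exists>n\<ge>1. s n \<in> B}
      \<in> sets (\<Pi>\<^sub>M i\<in>(UNIV::nat set). borel)"
    by measurable
  then show ?thesis by (simp add: space_PiM)
qed

section \<open>The path law as an image of the i.i.d. product measure\<close>

context random_walk
begin

lemma measurable_increment [measurable]: "X (Suc n) \<in> borel_measurable M"
proof -
  have "random_variable borel (if Suc n = 0 then S 0 else X (Suc n))"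
    using indep unfolding indep_vars_def2 by blast
  then show ?thesis by simp
qed

text \<open>The independent family has \<open>S 0\<close> at index 0; dropping that coordinate
  leaves the i.i.d. increments.\<close>

lemma distr_increments:
  "distr M (\<Pi>\<^sub>M i\<in>(UNIV::nat set). borel) (\<lambda>\<omega> i. X (Suc i) \<omega>) = (\<Pi>\<^sub>M i\<in>(UNIV::nat set). distr M borel (X 1))"
proof -
  let ?Y = "\<lambda>n. if n = 0 then S 0 else X n"
  have Y [measurable]: "?Y n \<in> borel_measurable M" for n
    using indep unfolding indep_vars_def2 by blast
  have joint: "distr M (\<Pi>\<^sub>M i\<in>(UNIV::nat set). borel) (\<lambda>\<omega> i. ?Y i \<omega>) = (\<Pi>\<^sub>M i\<in>(UNIV::nat set). distr M borel (?Y i))"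
    using indep by (subst (asm) indep_vars_iff_distr_eq_PiM) (simp_all add: restrict_UNIV)
  have "distr M (\<Pi>\<^sub>M i\<in>(UNIV::nat set). borel) (\<lambda>\<omega> i. X (Suc i) \<omega>) =
      distr (distr M (\<Pi>\<^sub>M i\<in>(UNIV::nat set). borel) (\<lambda>\<omega> i. ?Y i \<omega>)) (\<Pi>\<^sub>M i\<in>(UNIV::nat set). borel) shift"
    by (subst distr_distr) (auto simp: comp_def shift_def[abs_def] intro!: measurable_PiM_single')
  also have "\<dots> = distr (\<Pi>\<^sub>M i\<in>(UNIV::nat set). distr M borel (?Y i)) (\<Pi>\<^sub>M i\<in>(UNIV::nat set). distr M borel (?Y (Suc i)))
      (\<lambda>w. \<lambda>i\<in>UNIV. w (Suc i))"
    unfolding joint restrict_UNIV shift_def[abs_def]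
    by (rule distr_cong[OF refl sets_PiM_cong[OF refl] refl]) simp
  also have "\<dots> = (\<Pi>\<^sub>M i\<in>(UNIV::nat set). distr M borel (?Y (Suc i)))"
    by (rule distr_PiM_reindex) (use prob_space_distr[OF Y] in auto)
  also have "\<dots> = (\<Pi>\<^sub>M i\<in>(UNIV::nat set). distr M borel (X 1))"
  proof (rule PiM_cong[OF refl])
    show "distr M borel (?Y (Suc i)) = distr M borel (X 1)" for i
      using identically_distributed[of "Suc i"] by simp
  qed
  finally show ?thesis .
qed

lemma walk_law_eq:
  "walk_law M X x = distr (\<Pi>\<^sub>M i\<in>(UNIV::nat set). distr M borel (X 1)) (\<Pi>\<^sub>M i\<in>(UNIV::nat set). borel) (walk_path x)"
proof -
  have "walk_law M X x = distr M (\<Pi>\<^sub>M i\<in>(UNIV::nat set). borel) (walk_path x \<circ> (\<lambda>\<omega> i. X (Suc i) \<omega>))"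
    unfolding walk_law_def
    by (intro distr_cong refl) (simp add: fun_eq_iff walk_path_def sum.atLeast1_atMost_eq)
  also have "\<dots> = distr (distr M (\<Pi>\<^sub>M i\<in>(UNIV::nat set). borel) (\<lambda>\<omega> i. X (Suc i) \<omega>)) (\<Pi>\<^sub>M i\<in>(UNIV::nat set). borel) (walk_path x)"
    by (intro distr_distr[symmetric] measurable_walk_path_seq measurable_PiM_single') auto
  finally show ?thesis by (simp only: distr_increments)
qed

lemma space_walk_law: "space (walk_law M X x) = UNIV"
  by (simp add: walk_law_def space_PiM)

end

section \<open>Haar measure as an invariant measure of the walk\<close>

locale haar_walk = random_walk +
  fixes L :: "(real ^ 'b) measure" and Z :: "(real ^ 'b) set"
  assumes Z_eq: "Z = state_space M X" and haar: "haar_measure_on Z L"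
begin

text \<open>Pushing Haar measure forward along the inclusion of \<open>Z\<close> replaces
  measurability on \<open>Z\<close> by plain Borel measurability.\<close>

definition "\<mu> = distr L borel (\<lambda>x. x)"
definition "N = distr M borel (X 1)"

lemma closed_Z: "closed Z" and subgroup_Z: "add_subgroup Z"
  by (simp_all add: Z_eq closed_state_space add_subgroup_state_space)

lemma sets_Z [measurable]: "Z \<in> sets borel"
  using closed_Z by simp

lemma sets_L [measurable_cong]: "sets L = sets (restrict_space borel Z)"
  using haar by (simp add: haar_measure_on_def)

lemma space_L: "space L = Z"
  using sets_eq_imp_space_eq[OF sets_L] by (simp add: space_restrict_space)

lemma in_sets_L: "B \<in> sets borel \<Longrightarrow> B \<subseteq> Z \<Longrightarrow> B \<in> sets L"
  by (simp add: sets_L sets_restrict_space_iff)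

lemma measurable_L: "f \<in> measurable borel K \<Longrightarrow> f \<in> measurable L K"
  unfolding measurable_cong_sets[OF sets_L refl] by (rule measurable_restrict_space1)

lemma emeasure_\<mu>: "B \<in> sets borel \<Longrightarrow> emeasure \<mu> B = emeasure L (B \<inter> Z)"
  by (simp add: \<mu>_def emeasure_distr measurable_L space_L)

lemma nn_integral_\<mu>: "f \<in> borel_measurable borel \<Longrightarrow> (\<integral>\<^sup>+x. f x \<partial>\<mu>) = (\<integral>\<^sup>+x. f x \<partial>L)"
  by (simp add: \<mu>_def nn_integral_distr measurable_L)

lemma AE_\<mu>_Z: "AE x in \<mu>. x \<in> Z"
proof -
  have "- Z \<in> null_sets \<mu>"
    using sets_Z by (intro null_setsI) (simp_all add: emeasure_\<mu>, simp add: \<mu>_def)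
  then have "AE x in \<mu>. x \<notin> - Z" by (rule AE_not_in)
  then show ?thesis by simp
qed

lemma AE_\<mu>_if_AE_L:
  assumes "AE x in L. P x"
  shows "AE x in \<mu>. P x"
proof -
  from assms obtain C where C: "{x \<in> Z. \<not> P x} \<subseteq> C" "emeasure L C = 0" "C \<in> sets L"
    unfolding space_L[symmetric] by (elim AE_E)
  then have "C \<subseteq> Z" "C \<in> sets borel"
    by (simp_all add: sets_L sets_restrict_space_iff)
  then have "C \<in> null_sets \<mu>"
    using C by (intro null_setsI) (simp_all add: emeasure_\<mu> Int_absorb2, simp add: \<mu>_def)
  from AE_not_in[OF this] AE_\<mu>_Z show ?thesis
    by eventually_elim (use C in auto)
qed

lemma translate_\<mu>:
  assumes z: "z \<in> Z"
  shows "distr \<mu> borel (\<lambda>x. x + z) = \<mu>"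
proof (rule measure_eqI)
  show "sets (distr \<mu> borel (\<lambda>x. x + z)) = sets \<mu>" by (simp add: \<mu>_def)
  fix B assume "B \<in> sets (distr \<mu> borel (\<lambda>x. x + z))"
  then have B [measurable]: "B \<in> sets borel" by simp
  have pre [measurable]: "{x. x + z \<in> B} \<in> sets borel"
    using measurable_sets[of "\<lambda>x. x + z" borel borel B] by (simp add: vimage_def)
  have "emeasure (distr \<mu> borel (\<lambda>x. x + z)) B = emeasure L ({x. x + z \<in> B} \<inter> Z)"
    by (simp add: emeasure_distr \<mu>_def measurable_L vimage_def pre space_L comp_def distr_distr)
  also have "\<dots> = emeasure L ((+) z ` ({x. x + z \<in> B} \<inter> Z))"
  proof -
    have "{x. x + z \<in> B} \<inter> Z \<in> sets L" by (intro in_sets_L) auto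
    then show ?thesis using haar z by (auto simp: haar_measure_on_def)
  qed
  \<comment> \<open>Translation by \<open>z\<close> maps \<open>Z\<close> onto itself because
    \<open>Z\<close> is a group; the preimage of \<open>y\<close> is \<open>- z + y\<close>.\<close>
  also have "(+) z ` ({x. x + z \<in> B} \<inter> Z) = B \<inter> Z"
  proof (intro equalityI subsetI)
    fix y assume y: "y \<in> B \<inter> Z"
    then have "- z + y \<in> Z"
      using subgroup_Z z unfolding add_subgroup_def by blast
    with y show "y \<in> (+) z ` ({x. x + z \<in> B} \<inter> Z)"
      by (intro image_eqI[of _ _ "- z + y"]) auto
  qed (use subgroup_Z z in \<open>auto simp: add_subgroup_def add.commute\<close>)
  finally show "emeasure (distr \<mu> borel (\<lambda>x. x + z)) B = emeasure \<mu> B"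
    by (simp add: emeasure_\<mu>)
qed

text \<open>Closed balls meet the closed set \<open>Z\<close> in compact sets, on which Haar measure
  is finite.\<close>

lemma sigma_finite_\<mu>: "sigma_finite_measure \<mu>"
proof
  have "emeasure \<mu> (cball 0 (real n)) \<noteq> \<infinity>" for n
    using haar closed_Z unfolding haar_measure_on_def
    by (auto simp: emeasure_\<mu> compact_Int_closed less_top)
  then show "\<exists>A. countable A \<and> A \<subseteq> sets \<mu> \<and> \<Union> A = space \<mu> \<and> (\<forall>a\<in>A. emeasure \<mu> a \<noteq> \<infinity>)"
    by (intro exI[of _ "range (\<lambda>n. cball 0 (real n))"])
       (auto simp: \<mu>_def real_arch_simple)
qed

lemma AE_N_Z: "AE z in N. z \<in> Z"
proof -
  have "AE z in N. z \<in> top_support N"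
    by (rule AE_top_support) (simp add: N_def)
  then show ?thesis
    by eventually_elim (auto simp: N_def Z_eq state_space_def intro: hull_subset[THEN subsetD])
qed

sublocale W: invariant_walk \<mu> N
proof (intro invariant_walk.intro invariant_walk_axioms.intro sigma_finite_\<mu>)
  show "prob_space N" unfolding N_def by (rule prob_space_distr) (use measurable_increment[of 0] in simp)
  show "AE z in N. distr \<mu> borel (\<lambda>x. x + z) = \<mu>"
    using AE_N_Z by eventually_elim (rule translate_\<mu>)
qed (simp_all add: \<mu>_def N_def)

lemma emeasure_walk_law:
  assumes "E \<in> sets (\<Pi>\<^sub>M i\<in>(UNIV::nat set). borel)"
  shows "emeasure (walk_law M X x) E = emeasure W.Q {w. walk_path x w \<in> E}"
  using assms W.measurable_walk_path_Q[of x] unfolding walk_law_eq N_def[symmetric]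
  by (simp add: emeasure_distr vimage_def)

text \<open>The dual path from \<open>- x\<close> is the negative of the walk from \<open>x\<close>,
  so it hits \<open>A\<close> exactly when the walk hits the reflection of \<open>A\<close>.
  \<open>AE_reflect\<close> then replaces the start \<open>- x\<close> by \<open>x\<close>.\<close>

lemma AE_dual_hit:
  assumes mass: "massive M X L (uminus ` A)" and [measurable]: "A \<in> sets borel"
  shows "AE p in \<mu> \<Otimes>\<^sub>M W.Q. \<exists>n\<ge>1. dual_path (fst p) (snd p) n \<in> A"
proof -
  have [measurable]: "uminus ` A \<in> sets borel"
    using mass by (simp add: massive_def)
  have neg: "y \<in> uminus ` A \<longleftrightarrow> - y \<in> A" for y
    by force
  let ?E = "{s. \<exists>n\<ge>1. s n \<in> uminus ` A}"
  have "AE x in L. AE w in W.Q. \<exists>n\<ge>1. dual_path (- x) w n \<in> A"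
  proof -
    have "AE x in L. measure (walk_law M X x) ?E = 1"
      using mass unfolding massive_def hitting_time_finite_iff space_walk_law by simp
    then show ?thesis
    proof eventually_elim
      case (elim x)
      then have "W.Q.prob {w. walk_path x w \<in> ?E} = 1"
        by (simp only: measure_def emeasure_walk_law sets_hitting_paths \<open>uminus ` A \<in> sets borel\<close>)
      moreover have "{w. walk_path x w \<in> ?E} \<in> sets W.Q"
        using measurable_sets[OF W.measurable_walk_path_Q sets_hitting_paths[OF \<open>uminus ` A \<in> sets borel\<close>]]
        by (simp add: vimage_def)
      ultimately have "AE w in W.Q. w \<in> {w. walk_path x w \<in> ?E}"
        by (subst W.Q.AE_in_set_eq_1)
      then show ?case
        by eventually_elim (simp add: neg walk_path_def dual_path_def)
    qed
  qed
  then have "AE x in \<mu>. AE w in W.Q. \<exists>n\<ge>1. dual_path (- x) w n \<in> A"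
    by (rule AE_\<mu>_if_AE_L)
  then have "AE x in \<mu>. AE w in W.Q. \<exists>n\<ge>1. dual_path (- (- x)) w n \<in> A"
  proof (rule AE_reflect[rotated 3])
    show "AE z in \<mu>. distr \<mu> borel (\<lambda>x. x + z) = \<mu>"
      using AE_\<mu>_Z by eventually_elim (rule translate_\<mu>)
  qed (simp_all add: sigma_finite_\<mu>)
  then have ae: "AE x in \<mu>. AE w in W.Q. \<exists>n\<ge>1. dual_path (fst (x, w)) (snd (x, w)) n \<in> A"
    by simp
  show ?thesis
  proof (rule W.AE_pair_measure[OF _ ae])
    show "{p \<in> space (\<mu> \<Otimes>\<^sub>M W.Q). \<exists>n\<ge>1. dual_path (fst p) (snd p) n \<in> A} \<in> sets (\<mu> \<Otimes>\<^sub>M W.Q)"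
      by measurable
  qed
qed

section \<open>Invariance\<close>

lemma nn_integral_density_restrict:
  assumes [measurable]: "E \<in> sets borel" "d \<in> borel_measurable borel" "f \<in> borel_measurable borel"
    and E: "E \<subseteq> Z"
  shows "(\<integral>\<^sup>+x. f x \<partial>density (restrict_space L E) d) = (\<integral>\<^sup>+x. indicator E x * d x * f x \<partial>\<mu>)"
proof -
  have EL: "E \<inter> space L \<in> sets L"
    using E by (simp add: space_L in_sets_L Int_absorb2)
  have "(\<integral>\<^sup>+x. f x \<partial>density (restrict_space L E) d) = (\<integral>\<^sup>+x. d x * f x \<partial>restrict_space L E)"
    by (intro nn_integral_density measurable_restrict_space1 measurable_L) measurable
  also have "\<dots> = (\<integral>\<^sup>+x. d x * f x * indicator E x \<partial>L)"
    by (rule nn_integral_restrict_space[OF EL])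
  also have "\<dots> = (\<integral>\<^sup>+x. indicator E x * d x * f x \<partial>L)"
    by (simp add: mult_ac)
  also have "\<dots> = (\<integral>\<^sup>+x. indicator E x * d x * f x \<partial>\<mu>)"
    by (rule nn_integral_\<mu>[symmetric]) measurable
  finally show ?thesis .
qed

lemma sets_restrict_L:
  assumes "E \<subseteq> Z" "E \<in> sets borel"
  shows "sets (restrict_space L E) = sets (restrict_space borel E)"
proof -
  have "sets (restrict_space L E) = sets (restrict_space (restrict_space borel Z) E)"
    by (rule sets_restrict_space_cong) (rule sets_L)
  also have "\<dots> = sets (restrict_space borel (Z \<inter> E))"
    by (subst sets_restrict_restrict_space) simp
  finally show ?thesis using assms by (simp add: Int_absorb1)
qed

lemma emeasure_density_restrict:
  assumes [measurable]: "E \<in> sets borel" "d \<in> borel_measurable borel" "B \<in> sets borel"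
    and E: "E \<subseteq> Z" and B: "B \<subseteq> E"
  shows "emeasure (density (restrict_space L E) d) B = (\<integral>\<^sup>+x. indicator B x * d x \<partial>\<mu>)"
proof -
  have "B \<in> sets (density (restrict_space L E) d)"
    using B by (simp add: sets_restrict_L[OF E] sets_restrict_space_iff)
  then have "emeasure (density (restrict_space L E) d) B = (\<integral>\<^sup>+x. indicator B x \<partial>density (restrict_space L E) d)"
    by simp
  also have "\<dots> = (\<integral>\<^sup>+x. indicator E x * d x * indicator B x \<partial>\<mu>)"
    using E by (intro nn_integral_density_restrict) measurable
  also have "\<dots> = (\<integral>\<^sup>+x. indicator B x * d x \<partial>\<mu>)"
    using B by (intro nn_integral_cong) (auto simp: indicator_def)
  finally show ?thesis .
qed

text \<open>Reduces invariance to an identity between integrals over the whole space, the form in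
  which the balance of crossings is available.\<close>

lemma invariant_measure_densityI:
  assumes [measurable]: "E \<in> sets borel" "d \<in> borel_measurable borel" and E: "E \<subseteq> Z"
    and "\<And>B. B \<in> sets borel \<Longrightarrow> B \<subseteq> E \<Longrightarrow> (\<lambda>x. K x (Some ` B)) \<in> borel_measurable borel"
    and "\<And>B. B \<in> sets borel \<Longrightarrow> B \<subseteq> E \<Longrightarrow>
      (\<integral>\<^sup>+x. indicator E x * d x * K x (Some ` B) \<partial>\<mu>) = (\<integral>\<^sup>+x. indicator B x * d x \<partial>\<mu>)"
  shows "invariant_measure K E (density (restrict_space L E) d)"
  unfolding invariant_measure_def
proof (intro conjI ballI impI)
  show "sets (density (restrict_space L E) d) = sets (restrict_space borel E)"
    using sets_restrict_L[OF E assms(1)] by simp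
  fix B assume B: "B \<in> sets borel" "B \<subseteq> E"
  show "(\<integral>\<^sup>+x. K x (Some ` B) \<partial>density (restrict_space L E) d) = emeasure (density (restrict_space L E) d) B"
    using nn_integral_density_restrict[OF assms(1,2) assms(4)[OF B] E]
      emeasure_density_restrict[OF assms(1,2) B(1) E B(2)] assms(5)[OF B]
    by (simp only:)
qed

lemma entrance_kernel_eq:
  assumes "A \<in> sets borel" "B \<in> sets borel" "B \<subseteq> A"
  shows "entrance_kernel M X A x (Some ` B) = W.crossing_prob (Z - A) A (Z - A) B x"
proof -
  have "emeasure (walk_law M X x) {s. \<exists>k. first_crossing (Z - A) A (Z - A) B k s} =
      W.crossing_prob (Z - A) A (Z - A) B x"
    using assms sets_Z unfolding W.crossing_prob_def
    by (subst emeasure_walk_law) (auto intro!: sets_crossing_paths)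
  then show ?thesis
    using assms(3) by (simp add: entrance_kernel_def entrance_chain_1_iff[unfolded One_nat_def] space_walk_law Z_eq[symmetric])
qed

lemma emeasure_step: "B \<in> sets borel \<Longrightarrow> emeasure M {\<omega> \<in> space M. X 1 \<omega> \<in> B} = emeasure N B"
  using measurable_increment[of 0] by (simp add: N_def emeasure_distr vimage_def Int_def conj_commute)

lemma AE_transition:
  assumes "massive M X L (uminus ` A)" "massive M X L (uminus ` (Z - A))" "A \<in> sets borel" "A \<subseteq> Z"
  shows "AE p in \<mu> \<Otimes>\<^sub>M W.Q.
    \<exists>n\<ge>1. dual_path (fst p) (snd p) n \<in> A \<and> dual_path (fst p) (snd p) (Suc n) \<in> Z - A"
proof (rule W.AE_dual_transition)
  show "AE p in \<mu> \<Otimes>\<^sub>M W.Q. \<exists>n\<ge>1. dual_path (fst p) (snd p) n \<in> A"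
    using assms by (intro AE_dual_hit)
  show "AE p in \<mu> \<Otimes>\<^sub>M W.Q. \<exists>n\<ge>1. dual_path (fst p) (snd p) n \<in> Z - A"
    using assms sets_Z by (intro AE_dual_hit) auto
  show "AE p in \<mu> \<Otimes>\<^sub>M W.Q. dual_path (fst p) (snd p) 0 \<in> A \<union> (Z - A)"
  proof (rule W.AE_pair_measure)
    show "{p \<in> space (\<mu> \<Otimes>\<^sub>M W.Q). dual_path (fst p) (snd p) 0 \<in> A \<union> (Z - A)} \<in> sets (\<mu> \<Otimes>\<^sub>M W.Q)"
      using assms(3) by measurable
    show "AE x in \<mu>. AE w in W.Q. dual_path (fst (x, w)) (snd (x, w)) 0 \<in> A \<union> (Z - A)"
      using AE_\<mu>_Z by eventually_elim simp
  qed
qed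

lemma emeasure_preimage_diff:
  assumes "D \<in> sets borel"
  shows "emeasure N {s. x - s \<in> D} = (\<integral>\<^sup>+s. indicator D (x - s) \<partial>N)"
  using nn_integral_indicator[of "{s. x - s \<in> D}" N] assms by (simp add: indicator_def[abs_def])

lemma emeasure_preimage_add:
  assumes "D \<in> sets borel"
  shows "emeasure N {s. x + s \<in> D} = (\<integral>\<^sup>+s. indicator D (x + s) \<partial>N)"
  using nn_integral_indicator[of "{s. x + s \<in> D}" N] assms by (simp add: indicator_def[abs_def])

context
  fixes A
  assumes A [measurable]: "A \<in> sets borel" and AZ: "A \<subseteq> Z"
    and massive: "massive M X L (uminus ` A)" "massive M X L (uminus ` (Z - A))"
begin

lemma sets_complement: "Z - A \<in> sets borel"
  using sets_Z A by (rule sets.Diff)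

text \<open>The density at a point of \<open>A\<close> is the flux of steps that enter
  \<open>A\<close> there. Step duality rewrites the left side as a flux of two successive crossings,
  the balance with \<open>B1 = Z - A\<close> and \<open>B2 = B\<close> reduces it to one step into
  \<open>B\<close>, and duality leads back to the density.\<close>

lemma invariant_entrance:
  "invariant_measure (entrance_kernel M X A) A
     (density (restrict_space L A)
       (\<lambda>x. emeasure M {\<omega> \<in> space M. X 1 \<omega> \<in> (\<lambda>a. x - a) ` (Z - A)}))"
proof -
  have "(\<lambda>a. x - a) ` (Z - A) = {s. x - s \<in> Z - A}" for x
  proof (intro equalityI subsetI)
    fix s assume "s \<in> {s. x - s \<in> Z - A}"
    then show "s \<in> (\<lambda>a. x - a) ` (Z - A)"
      by (intro image_eqI[of _ _ "x - s"]) auto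
  qed auto
  then have dens: "emeasure M {\<omega> \<in> space M. X 1 \<omega> \<in> (\<lambda>a. x - a) ` (Z - A)} = emeasure N {s. x - s \<in> Z - A}" for x
    by (simp only:) (rule emeasure_step, measurable)
  show ?thesis unfolding dens
  proof (rule invariant_measure_densityI)
    show "(\<lambda>x. emeasure N {s. x - s \<in> Z - A}) \<in> borel_measurable borel"
      by (simp only: emeasure_preimage_diff sets.Diff sets_Z A) measurable
    fix B assume B [measurable]: "B \<in> sets borel" and BA: "B \<subseteq> A"
    note K = entrance_kernel_eq[OF A B BA]
    show "(\<lambda>x. entrance_kernel M X A x (Some ` B)) \<in> borel_measurable borel"
      unfolding K by measurable
    let ?H = "W.crossing_prob (Z - A) A (Z - A) B"
    have "(\<integral>\<^sup>+x. indicator A x * emeasure N {s. x - s \<in> Z - A} * ?H x \<partial>\<mu>) =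
        (\<integral>\<^sup>+x. (indicator A x * ?H x) * emeasure N {s. x - s \<in> Z - A} \<partial>\<mu>)"
      by (simp add: mult_ac)
    also have "\<dots> = (\<integral>\<^sup>+x. indicator (Z - A) x * (\<integral>\<^sup>+s. indicator A (x + s) * ?H (x + s) \<partial>N) \<partial>\<mu>)"
      by (rule W.nn_integral_step_duality[symmetric]) measurable
    also have "\<dots> = (\<integral>\<^sup>+x. indicator (Z - A) x * (\<integral>\<^sup>+s. indicator B (x + s) \<partial>N) \<partial>\<mu>)"
      by (rule W.crossing_prob_balance[OF A sets_complement sets_complement B subset_refl BA AE_transition[OF massive A AZ]])
    also have "\<dots> = (\<integral>\<^sup>+x. indicator B x * emeasure N {s. x - s \<in> Z - A} \<partial>\<mu>)"
      by (rule W.nn_integral_step_duality) measurable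
    finally show "(\<integral>\<^sup>+x. indicator A x * emeasure N {s. x - s \<in> Z - A} * entrance_kernel M X A x (Some ` B) \<partial>\<mu>) =
        (\<integral>\<^sup>+x. indicator B x * emeasure N {s. x - s \<in> Z - A} \<partial>\<mu>)"
      unfolding K .
  qed (use A AZ in auto)
qed

text \<open>Conditioning divides by the probability of stepping into \<open>A\<close>. In the other
  case the value is 0, since the cemetery state is not in the image of \<open>B\<close> under
  \<open>Some\<close>.\<close>

lemma exit_kernel_eq:
  assumes B [measurable]: "B \<in> sets borel" and BD: "B \<subseteq> Z - A"
  shows "exit_kernel M X A x (Some ` B) =
    (if emeasure N {s. x + s \<in> A} > 0
     then (\<integral>\<^sup>+s. indicator A (x + s) * W.crossing_prob (Z - A) A B A (x + s) \<partial>N) / emeasure N {s. x + s \<in> A}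
     else 0)"
proof -
  let ?H = "W.crossing_prob (Z - A) A B A"
  have H: "emeasure (walk_law M X z) {s \<in> space (walk_law M X z). exit_chain (state_space M X) A s 1 \<in> Some ` B} = ?H z" for z
    unfolding Z_eq[symmetric] exit_chain_1_iff[OF BD] space_walk_law W.crossing_prob_def
    by (subst emeasure_walk_law) (simp_all add: sets_crossing_paths)
  have step: "distr (walk_law M X x) borel (\<lambda>s. s 1) = distr N borel (\<lambda>s. x + s)"
  proof -
    have "distr (walk_law M X x) borel (\<lambda>s. s 1) = distr W.Q borel (\<lambda>w. x + w 0)"
      unfolding walk_law_eq N_def[symmetric]
      by (subst distr_distr[OF _ W.measurable_walk_path_Q]) (simp_all add: comp_def walk_path_def)
    also have "\<dots> = distr (distr W.Q N (\<lambda>w. w 0)) borel (\<lambda>s. x + s)"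
      by (subst distr_distr) (simp_all add: comp_def)
    finally show ?thesis unfolding W.Q.PiM_component[OF UNIV_I] .
  qed
  have emeasure_shifted: "emeasure (distr N borel (\<lambda>s. x + s)) A = emeasure N {s. x + s \<in> A}"
    by (simp add: emeasure_distr vimage_def)
  have pos: "\<P>(s in walk_law M X x. s 1 \<in> A) > 0 \<longleftrightarrow> emeasure N {s. x + s \<in> A} > 0"
  proof -
    have "{s. s 1 \<in> A} \<in> sets (\<Pi>\<^sub>M i\<in>(UNIV::nat set). (borel :: (real ^ 'b) measure))"
    proof -
      have "{s \<in> space (\<Pi>\<^sub>M i\<in>(UNIV::nat set). (borel :: (real ^ 'b) measure)). s 1 \<in> A} \<in> sets (\<Pi>\<^sub>M i\<in>(UNIV::nat set). borel)"
        by measurable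
      then show ?thesis by (simp add: space_PiM)
    qed
    then have "emeasure (walk_law M X x) {s. s 1 \<in> A} = emeasure (distr (walk_law M X x) borel (\<lambda>s. s 1)) A"
      by (subst emeasure_distr) (simp_all add: space_walk_law vimage_def walk_law_def)
    then have "emeasure (walk_law M X x) {s. s 1 \<in> A} = emeasure N {s. x + s \<in> A}"
      unfolding step emeasure_shifted .
    then show ?thesis
      using W.N.emeasure_finite[of "{s. x + s \<in> A}"]
      by (simp add: space_walk_law measure_def enn2real_positive_iff less_top[symmetric])
  qed
  have "(\<integral>\<^sup>+z\<in>A. ?H z \<partial>(uniform_measure (distr N borel (\<lambda>s. x + s)) A)) =
      (\<integral>\<^sup>+s. indicator A (x + s) * ?H (x + s) \<partial>N) / emeasure N {s. x + s \<in> A}"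
  proof -
    \<comment> \<open>One indicator of \<open>A\<close> comes from the set integral, the other from
      conditioning.\<close>
    have "(\<integral>\<^sup>+z\<in>A. ?H z \<partial>(uniform_measure (distr N borel (\<lambda>s. x + s)) A)) =
        (\<integral>\<^sup>+z. ?H z * indicator A z * indicator A z \<partial>distr N borel (\<lambda>s. x + s)) / emeasure N {s. x + s \<in> A}"
      by (subst nn_integral_uniform_measure) (simp_all add: emeasure_shifted)
    also have "(\<integral>\<^sup>+z. ?H z * indicator A z * indicator A z \<partial>distr N borel (\<lambda>s. x + s)) =
        (\<integral>\<^sup>+s. indicator A (x + s) * ?H (x + s) \<partial>N)"
      by (subst nn_integral_distr) (auto intro!: nn_integral_cong simp: indicator_def)
    finally show ?thesis .
  qed
  then show ?thesis
    unfolding exit_kernel_def H step pos by (simp add: indicator_def image_iff)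
qed

text \<open>The density is exactly the denominator in the exit kernel. Once it cancels, the balance
  with \<open>B1 = B\<close> and \<open>B2 = A\<close> applies directly.\<close>

lemma invariant_exit:
  "invariant_measure (exit_kernel M X A) (Z - A)
     (density (restrict_space L (Z - A))
       (\<lambda>x. emeasure M {\<omega> \<in> space M. X 1 \<omega> \<in> (\<lambda>a. a - x) ` A}))"
proof -
  have "(\<lambda>a. a - x) ` A = {s. x + s \<in> A}" for x
  proof (intro equalityI subsetI)
    fix s assume "s \<in> {s. x + s \<in> A}"
    then show "s \<in> (\<lambda>a. a - x) ` A"
      by (intro image_eqI[of _ _ "x + s"]) auto
  qed auto
  then have dens: "emeasure M {\<omega> \<in> space M. X 1 \<omega> \<in> (\<lambda>a. a - x) ` A} = emeasure N {s. x + s \<in> A}" for x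
    by (simp only:) (rule emeasure_step, measurable)
  have meas [measurable]: "(\<lambda>x. emeasure N {s. x + s \<in> A}) \<in> borel_measurable borel"
    by (simp only: emeasure_preimage_add A) measurable
  show ?thesis unfolding dens
  proof (rule invariant_measure_densityI)
    fix B assume B [measurable]: "B \<in> sets borel" and BD: "B \<subseteq> Z - A"
    note K = exit_kernel_eq[OF B BD]
    show "(\<lambda>x. exit_kernel M X A x (Some ` B)) \<in> borel_measurable borel"
      unfolding K by measurable
    let ?H = "W.crossing_prob (Z - A) A B A"
    \<comment> \<open>Where the weight is zero, \<open>x + s\<close> misses \<open>A\<close> almost
      surely and both sides vanish; elsewhere the weight is positive and finite and cancels.\<close>
    have "emeasure N {s. x + s \<in> A} * exit_kernel M X A x (Some ` B) =
        (\<integral>\<^sup>+s. indicator A (x + s) * ?H (x + s) \<partial>N)" for x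
    proof (cases "emeasure N {s. x + s \<in> A} = 0")
      case True
      then have ae: "AE s in N. indicator A (x + s) = (0::ennreal)"
        unfolding emeasure_preimage_add[OF A] by (subst (asm) nn_integral_0_iff_AE) auto
      have "(\<integral>\<^sup>+s. indicator A (x + s) * ?H (x + s) \<partial>N) = (\<integral>\<^sup>+s. 0 \<partial>N)"
      proof (rule nn_integral_cong_AE)
        from ae show "AE s in N. indicator A (x + s) * ?H (x + s) = 0"
          by eventually_elim simp
      qed
      with True show ?thesis by simp
    next
      case False
      let ?q = "emeasure N {s. x + s \<in> A}"
      let ?I = "\<integral>\<^sup>+s. indicator A (x + s) * ?H (x + s) \<partial>N"
      have "?q * exit_kernel M X A x (Some ` B) = ?I * ?q / ?q"
        using False unfolding K by (simp add: zero_less_iff_neq_zero ennreal_times_divide mult.commute)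
      also have "\<dots> = ?I"
        using False by (rule mult_divide_eq_ennreal) simp
      finally show ?thesis .
    qed
    then have "(\<integral>\<^sup>+x. indicator (Z - A) x * emeasure N {s. x + s \<in> A} * exit_kernel M X A x (Some ` B) \<partial>\<mu>) =
        (\<integral>\<^sup>+x. indicator (Z - A) x * (\<integral>\<^sup>+s. indicator A (x + s) * ?H (x + s) \<partial>N) \<partial>\<mu>)"
      by (simp add: mult.assoc)
    also have "\<dots> = (\<integral>\<^sup>+x. indicator B x * (\<integral>\<^sup>+s. indicator A (x + s) \<partial>N) \<partial>\<mu>)"
      by (rule W.crossing_prob_balance[OF A sets_complement B A BD subset_refl AE_transition[OF massive A AZ]])
    finally show "(\<integral>\<^sup>+x. indicator (Z - A) x * emeasure N {s. x + s \<in> A} * exit_kernel M X A x (Some ` B) \<partial>\<mu>) =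
        (\<integral>\<^sup>+x. indicator B x * emeasure N {s. x + s \<in> A} \<partial>\<mu>)"
      by (simp only: emeasure_preimage_add A)
  qed (use A AZ in auto)
qed

end

end

theorem theorem5p1:
  fixes M :: "'w measure" and X S :: "nat \<Rightarrow> 'w \<Rightarrow> real ^ 'd"
    and L :: "(real ^ 'd) measure" and Z A :: "(real ^ 'd) set"
  assumes "random_walk M X S"
    and "Z = state_space M X"
    and "normalized_haar_on Z L"
    and "A \<in> sets borel" and "A \<subseteq> Z"
    and "massive M X L A" and "massive M X L (uminus ` A)"
    and "massive M X L (Z - A)" and "massive M X L (uminus ` (Z - A))"
  shows "invariant_measure (entrance_kernel M X A) A
           (density (restrict_space L A)
             (\<lambda>x. emeasure M {\<omega> \<in> space M. X 1 \<omega> \<in> (\<lambda>a. x - a) ` (Z - A)}))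
       \<and> invariant_measure (exit_kernel M X A) (Z - A)
           (density (restrict_space L (Z - A))
             (\<lambda>x. emeasure M {\<omega> \<in> space M. X 1 \<omega> \<in> (\<lambda>a. a - x) ` A}))"
proof -
  have "haar_walk M X S L Z"
    using assms(1-3) by (simp add: haar_walk_def haar_walk_axioms_def normalized_haar_on_def)
  then interpret haar_walk M X S L Z .
  show ?thesis
    using invariant_entrance[OF assms(4,5,7,9)] invariant_exit[OF assms(4,5,7,9)] ..
qed

end
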